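(* Let $n\ge 2$ be an integer, $\lambda>\frac{1}{n-1}$ and $\mu>0$. Then there exists a unique even solution $r\in C^2(\mathbb{R})$ of the problem $$\left\{\begin{aligned}&\frac{r''(y)}{1+r'(y)^2}=\frac{n-1}{r(y)}-\frac{1+r'(y)^2}{\lambda(r(y)-yr'(y))},\quad r(y)>0,\quad\forall y\in\mathbb{R},\\ &r(0)=\mu,\quad r'(0)=0,\end{aligned}\right.$$ which satisfies $$r(y)>yr'(y)\quad\forall y\in\mathbb{R}$$ and $$r''(0)=\left(n-1-\frac{1}{\lambda}\right)\frac{1}{\mu}.$$
   Context: Here $r'$ and $r''$ denote the first and second derivatives with respect to $y$. Being a solution of the equation includes that the denominator $r(y)-yr'(y)$ does not vanish. *)

theory Defs
  imports "HOL-Analysis.Analysis"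
begin

definition C2 :: "(real \<Rightarrow> real) \<Rightarrow> bool" where
  "C2 r \<longleftrightarrow>
     (\<forall>y. r differentiable (at y)) \<and>
     (\<forall>y. deriv r differentiable (at y)) \<and>
     continuous_on UNIV (deriv (deriv r))"

definition even_fun :: "(real \<Rightarrow> real) \<Rightarrow> bool" where
  "even_fun r \<longleftrightarrow> (\<forall>y. r (- y) = r y)"

text \<open>Division by zero is total in HOL, so the requirement that the denominator
  \<open>r y - y * deriv r y\<close> does not vanish has to be part of the notion of solution.
  Only non-vanishing is required here, not positivity.\<close>

definition is_solution :: "nat \<Rightarrow> real \<Rightarrow> real \<Rightarrow> (real \<Rightarrow> real) \<Rightarrow> bool" where
  "is_solution n lam \<mu> r \<longleftrightarrow>
     C2 r \<and>
     (\<forall>y. r y - y * deriv r y \<noteq> 0 \<and>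
          deriv (deriv r) y / (1 + (deriv r y)\<^sup>2) =
            (real n - 1) / r y - (1 + (deriv r y)\<^sup>2) / (lam * (r y - y * deriv r y)) \<and>
          r y > 0) \<and>
     r 0 = \<mu> \<and> deriv r 0 = 0"

end

theory Submission
  imports Defs
begin

text \<open>
  Put \<open>c = n - 1\<close> and \<open>w = r - y r'\<close>, so that \<open>w' = - y r''\<close> and \<open>r''\<close> has the sign of
  \<open>c \<lambda> w - (1 + r'\<^sup>2) r\<close> wherever \<open>r, w > 0\<close>. For \<open>y \<ge> 0\<close> the set
  \<open>r \<ge> \<mu>\<close>, \<open>0 \<le> r'\<close>, \<open>1 + r'\<^sup>2 \<le> c \<lambda>\<close>, \<open>w \<ge> \<mu> / (c \<lambda>)\<close> is invariant: at \<open>r' = 0\<close> the sign is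
  positive because \<open>w = r\<close> and \<open>c \<lambda> > 1\<close>; at \<open>1 + r'\<^sup>2 = c \<lambda>\<close> it is that of \<open>- y r' < 0\<close>; and at
  \<open>w = \<mu> / (c \<lambda>)\<close> it is negative because \<open>r > \<mu>\<close>, so that \<open>w\<close> increases. Clamping the right-hand
  side outside this set makes it globally Lipschitz in \<open>(r, r')\<close>, locally uniformly in \<open>y\<close>, and
  changes none of the even solutions. Existence and uniqueness thus follow from the global
  Picard-Lindeloef theorem, and evenness from uniqueness and the reflection symmetry.
\<close>

subsection \<open>Global solutions of Lipschitz equations\<close>

text \<open>Mean value inequality against the primitive \<open>a / b * exp (b * s)\<close> of the
  bound; its value \<open>a / b\<close> at \<open>0\<close> is nonnegative and is dropped.\<close>

lemma norm_le_exp_if_deriv_le_exp_nonneg: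
  fixes V :: "real \<Rightarrow> 'a::real_normed_vector"
  assumes "V 0 = 0" and "b > 0" and "a \<ge> 0"
    and V': "\<And>s. \<bar>s\<bar> \<le> T \<Longrightarrow> (V has_vector_derivative V' s) (at s)"
    and le: "\<And>s. \<bar>s\<bar> \<le> T \<Longrightarrow> norm (V' s) \<le> a * exp (b * \<bar>s\<bar>)"
    and "0 \<le> t" "t \<le> T"
  shows "norm (V t) \<le> a / b * exp (b * t)"
proof (cases "t = 0")
  case True
  then show ?thesis using assms(1-3) by simp
next
  case False
  let ?\<phi> = "\<lambda>s. a / b * exp (b * s)"
  have "norm (V t - V 0) \<le> ?\<phi> t - ?\<phi> 0"
  proof (rule differentiable_bound_general)
    show "0 < t" using False assms by simp
    show "continuous_on {0..t} V"
      using assms(7)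
      by (intro continuous_at_imp_continuous_on ballI has_vector_derivative_continuous[OF V']) auto
    show "continuous_on {0..t} ?\<phi>" by (intro continuous_intros)
    show "(V has_vector_derivative V' x) (at x)" if "0 < x" "x < t" for x
      using V' that assms by simp
    show "(?\<phi> has_vector_derivative a * exp (b * x)) (at x)" for x
      unfolding has_real_derivative_iff_has_vector_derivative[symmetric]
      using \<open>b > 0\<close> by (auto intro!: derivative_eq_intros)
    show "norm (V' x) \<le> a * exp (b * x)" if "0 < x" "x < t" for x
      using le[of x] that assms by simp
  qed
  moreover have "a / b \<ge> 0" using assms by simp
  ultimately show ?thesis using \<open>V 0 = 0\<close> by simp
qed

lemma norm_le_exp_if_deriv_le_exp:
  fixes V :: "real \<Rightarrow> 'a::real_normed_vector"
  assumes "V 0 = 0" and "b > 0" and "a \<ge> 0"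
    and V': "\<And>s. \<bar>s\<bar> \<le> T \<Longrightarrow> (V has_vector_derivative V' s) (at s)"
    and le: "\<And>s. \<bar>s\<bar> \<le> T \<Longrightarrow> norm (V' s) \<le> a * exp (b * \<bar>s\<bar>)"
    and "\<bar>t\<bar> \<le> T"
  shows "norm (V t) \<le> a / b * exp (b * \<bar>t\<bar>)"
proof (cases "t \<ge> 0")
  case True
  then show ?thesis
    using norm_le_exp_if_deriv_le_exp_nonneg[of V b a T V' t] assms by simp
next
  case False
  have "((\<lambda>s. V (- s)) has_vector_derivative - V' (- s)) (at s)" if "\<bar>s\<bar> \<le> T" for s
    using vector_diff_chain_at[of uminus "-1" s V "V' (- s)"] V'[of "- s"] that
      has_vector_derivative_minus[OF has_vector_derivative_id]
    by (simp add: o_def)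
  then have "norm (V (- (- t))) \<le> a / b * exp (b * (- t))"
    by (rule norm_le_exp_if_deriv_le_exp_nonneg[where T = T and V' = "\<lambda>s. - V' (- s)", rotated 3])
      (use assms False le[of "- _"] in auto)
  then show ?thesis using False by simp
qed

text \<open>Weighting by \<open>exp (2 L \<bar>t\<bar>)\<close> makes the Picard operator a contraction with factor \<open>1/2\<close>,
  uniformly on every bounded interval.\<close>

lemma picard_contraction:
  fixes D :: "real \<Rightarrow> 'a::real_normed_vector" and E :: "real \<Rightarrow> 'b::real_normed_vector"
  assumes "D 0 = 0" and "L > 0" and "a \<ge> 0"
    and D': "\<And>s. (D has_vector_derivative D' s) (at s)"
    and le: "\<And>s. \<bar>s\<bar> \<le> T \<Longrightarrow> norm (D' s) \<le> L * norm (E s)"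
    and E: "\<And>s. \<bar>s\<bar> \<le> T \<Longrightarrow> norm (E s) \<le> a * exp (2 * L * \<bar>s\<bar>)"
    and "\<bar>t\<bar> \<le> T"
  shows "norm (D t) \<le> a / 2 * exp (2 * L * \<bar>t\<bar>)"
proof -
  \<comment> \<open>The Lipschitz bound contributes a factor \<open>L\<close>, integrating the
    weight divides by \<open>2 * L\<close>; the quotient is the contraction factor
    \<open>1/2\<close>.\<close>
  have "norm (D t) \<le> L * a / (2 * L) * exp (2 * L * \<bar>t\<bar>)"
  proof (rule norm_le_exp_if_deriv_le_exp[OF _ _ _ D' _ \<open>\<bar>t\<bar> \<le> T\<close>])
    fix s assume s: "\<bar>s\<bar> \<le> T"
    have "norm (D' s) \<le> L * norm (E s)" by (rule le[OF s])
    also have "\<dots> \<le> L * (a * exp (2 * L * \<bar>s\<bar>))"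
      using \<open>L > 0\<close> by (intro mult_left_mono E s) auto
    finally show "norm (D' s) \<le> L * a * exp (2 * L * \<bar>s\<bar>)" by (simp add: mult.assoc)
  qed (use assms in auto)
  then show ?thesis using \<open>L > 0\<close> by simp
qed

text \<open>Starting bound for the iterations below. \<open>C\<close> bounds \<open>g\<close> on the
  compact interval and \<open>exp (L * \<bar>t\<bar>) \<ge> 1\<close>, so \<open>C\<close> does not
  depend on the weight \<open>L\<close>.\<close>

lemma continuous_bound_exp:
  fixes g :: "real \<Rightarrow> 'a::real_normed_vector"
  assumes "continuous_on UNIV g"
  obtains C where "C \<ge> 0" and "\<And>t L. \<bar>t\<bar> \<le> T \<Longrightarrow> L \<ge> 0 \<Longrightarrow> norm (g t) \<le> C * exp (L * \<bar>t\<bar>)"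
proof -
  have "bounded (g ` {-T..T})"
    by (intro compact_imp_bounded compact_continuous_image continuous_on_subset[OF assms]) auto
  then obtain C where C: "\<And>t. \<bar>t\<bar> \<le> T \<Longrightarrow> norm (g t) \<le> C"
    unfolding bounded_iff by (force simp: abs_le_iff)
  have "norm (g t) \<le> \<bar>C\<bar> * exp (L * \<bar>t\<bar>)" if "\<bar>t\<bar> \<le> T" "L \<ge> 0" for t L
  proof -
    have "norm (g t) \<le> \<bar>C\<bar> * 1" using C[OF that(1)] by simp
    also have "\<dots> \<le> \<bar>C\<bar> * exp (L * \<bar>t\<bar>)" using that by (intro mult_left_mono) auto
    finally show ?thesis .
  qed
  then show ?thesis by (intro that[of "\<bar>C\<bar>"]) auto
qed

text \<open>With \<open>D = E = u - v\<close> the contraction estimate can be iterated: each round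
  halves the weighted bound on the difference, so the difference vanishes.\<close>

lemma ode_unique:
  fixes f :: "real \<Rightarrow> 'a::real_normed_vector \<Rightarrow> 'a"
  assumes lip: "\<And>T. \<exists>L. \<forall>t x y. \<bar>t\<bar> \<le> T \<longrightarrow> norm (f t x - f t y) \<le> L * norm (x - y)"
    and u: "\<And>t. (u has_vector_derivative f t (u t)) (at t)"
    and v: "\<And>t. (v has_vector_derivative f t (v t)) (at t)"
    and "u 0 = v 0"
  shows "u = v"
proof
  fix t0 :: real
  obtain L0 where L0: "\<And>t x y. \<bar>t\<bar> \<le> \<bar>t0\<bar> \<Longrightarrow> norm (f t x - f t y) \<le> L0 * norm (x - y)"
    using lip[of "\<bar>t0\<bar>"] by blast
  \<comment> \<open>\<open>lip\<close> does not fix the sign of its constant; the contraction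
    estimate needs a positive one.\<close>
  define L where "L = \<bar>L0\<bar> + 1"
  have L: "norm (f t x - f t y) \<le> L * norm (x - y)" if "\<bar>t\<bar> \<le> \<bar>t0\<bar>" for t x y
    by (rule order_trans[OF L0[OF that]]) (auto simp: L_def intro!: mult_right_mono)
  have "L > 0" by (simp add: L_def)
  have D': "((\<lambda>t. u t - v t) has_vector_derivative f t (u t) - f t (v t)) (at t)" for t
    by (intro has_vector_derivative_diff u v)
  have "continuous_on UNIV (\<lambda>t. u t - v t)"
    by (intro continuous_at_imp_continuous_on ballI has_vector_derivative_continuous[OF D'])
  then obtain C where "C \<ge> 0"
    and C: "\<And>t L. \<bar>t\<bar> \<le> \<bar>t0\<bar> \<Longrightarrow> L \<ge> 0 \<Longrightarrow> norm (u t - v t) \<le> C * exp (L * \<bar>t\<bar>)"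
    by (rule continuous_bound_exp[where T = "\<bar>t0\<bar>"]) (rule that, assumption, blast)
  have est: "norm (u t - v t) \<le> C * (1/2) ^ k * exp (2 * L * \<bar>t\<bar>)" if "\<bar>t\<bar> \<le> \<bar>t0\<bar>" for k t
    using that
  proof (induction k arbitrary: t)
    case 0
    then show ?case using C[of t "2 * L"] \<open>L > 0\<close> by simp
  next
    case (Suc k)
    show ?case
      using picard_contraction[OF _ \<open>L > 0\<close> _ D' L Suc.IH Suc.prems] \<open>C \<ge> 0\<close> \<open>u 0 = v 0\<close> by simp
  qed
  have "(\<lambda>k. C * (1/2) ^ k * exp (2 * L * \<bar>t0\<bar>)) \<longlonglongrightarrow> C * 0 * exp (2 * L * \<bar>t0\<bar>)"
    by (intro tendsto_intros LIMSEQ_power_zero) auto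
  from LIMSEQ_le_const[OF this, of "norm (u t0 - v t0)"]
  show "u t0 = v t0" using est[of t0] by auto
qed

text \<open>Picard iteration from the constant \<open>x0\<close>. On bounded intervals the iterates
  converge uniformly at a geometric rate; by the Lipschitz bound so do their derivatives, and the
  limit may be differentiated. Continuity of \<open>f\<close> enters only along continuous curves,
  where antiderivatives are taken.\<close>

lemma ode_exists:
  fixes f :: "real \<Rightarrow> 'a::euclidean_space \<Rightarrow> 'a"
  assumes lip: "\<And>T. \<exists>L. \<forall>t x y. \<bar>t\<bar> \<le> T \<longrightarrow> norm (f t x - f t y) \<le> L * norm (x - y)"
    and cont: "\<And>u. continuous_on UNIV u \<Longrightarrow> continuous_on UNIV (\<lambda>t. f t (u t))"
  obtains u where "u 0 = x0" and "\<And>t. (u has_vector_derivative f t (u t)) (at t)"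
proof -
  have anti: "\<exists>v. v 0 = x0 \<and> (\<forall>t. (v has_vector_derivative f t (u t)) (at t))"
    if "continuous_on UNIV u" for u
  proof -
    have "\<exists>F. \<forall>x. -\<infinity> < ereal x \<longrightarrow> ereal x < \<infinity> \<longrightarrow> (F has_vector_derivative f x (u x)) (at x)"
      using cont[OF that]
      by (intro einterval_antiderivative) (auto simp: continuous_on_eq_continuous_at)
    then obtain F where F: "\<And>x. (F has_vector_derivative f x (u x)) (at x)" by auto
    have "((\<lambda>x. F x + (x0 - F 0)) has_vector_derivative f x (u x)) (at x)" for x
      using has_vector_derivative_add[OF F has_vector_derivative_const] by simp
    then show ?thesis by (intro exI[of _ "\<lambda>x. F x + (x0 - F 0)"]) simp
  qed
  \<comment> \<open>\<open>Q u v\<close> says that \<open>v\<close> is the Picard iterate of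
    \<open>u\<close>. It is a relation because antiderivatives are chosen, not written as
    integrals.\<close>
  define Q where "Q u v \<longleftrightarrow> v 0 = x0 \<and> (\<forall>t. (v has_vector_derivative f t (u t)) (at t))"
    for u v :: "real \<Rightarrow> 'a"
  have "\<exists>U. \<forall>k. (continuous_on UNIV (U k) \<and> (k = 0 \<longrightarrow> U k = (\<lambda>_. x0))) \<and> Q (U k) (U (Suc k))"
  proof (rule dependent_nat_choice)
    show "\<exists>u. continuous_on UNIV u \<and> ((0::nat) = 0 \<longrightarrow> u = (\<lambda>_. x0))" by auto
    fix u :: "real \<Rightarrow> 'a" and k :: nat
    assume "continuous_on UNIV u \<and> (k = 0 \<longrightarrow> u = (\<lambda>_. x0))"
    then obtain v where v: "Q u v" using anti[of u] unfolding Q_def by auto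
    then have "continuous_on UNIV v"
      unfolding Q_def
      by (intro continuous_at_imp_continuous_on ballI) (blast intro: has_vector_derivative_continuous)
    then show "\<exists>v. (continuous_on UNIV v \<and> (Suc k = 0 \<longrightarrow> v = (\<lambda>_. x0))) \<and> Q u v"
      using v by auto
  qed
  then obtain U where U0: "U 0 = (\<lambda>_. x0)" and Uc: "\<And>k. continuous_on UNIV (U k)"
    and US: "\<And>k. Q (U k) (U (Suc k))" by metis
  have Ux: "U k 0 = x0" for k using U0 US[of "k - 1"] by (cases k) (auto simp: Q_def)
  have U': "(U (Suc k) has_vector_derivative f t (U k t)) (at t)" for k t
    using US[of k] by (auto simp: Q_def)
  have local: "\<exists>A. \<forall>k m t. \<bar>t\<bar> \<le> T \<longrightarrow> norm (U (k + m) t - U k t) \<le> A * (1/2) ^ k" for T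
  proof (cases "T \<ge> 0")
    case False
    then have "\<not> \<bar>t\<bar> \<le> T" for t by linarith
    then show ?thesis by blast
  next
    case True
    obtain L0 where L0: "\<And>t x y. \<bar>t\<bar> \<le> T \<Longrightarrow> norm (f t x - f t y) \<le> L0 * norm (x - y)"
      using lip[of T] by blast
    define L where "L = \<bar>L0\<bar> + 1"
    have L: "norm (f t x - f t y) \<le> L * norm (x - y)" if "\<bar>t\<bar> \<le> T" for t x y
      by (rule order_trans[OF L0[OF that]]) (auto simp: L_def intro!: mult_right_mono)
    have "L > 0" by (simp add: L_def)
    have D': "((\<lambda>t. U (Suc (Suc k)) t - U (Suc k) t) has_vector_derivative
        f t (U (Suc k) t) - f t (U k t)) (at t)" for k t
      by (intro has_vector_derivative_diff U')
    have "continuous_on UNIV (\<lambda>t. U 1 t - U 0 t)"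
      by (intro continuous_intros Uc)
    then obtain C where "C \<ge> 0"
      and C: "\<And>t L. \<bar>t\<bar> \<le> T \<Longrightarrow> L \<ge> 0 \<Longrightarrow> norm (U 1 t - U 0 t) \<le> C * exp (L * \<bar>t\<bar>)"
      by (rule continuous_bound_exp[where T = T]) (rule that, assumption, blast)
    have est: "norm (U (Suc k) t - U k t) \<le> C * (1/2) ^ k * exp (2 * L * \<bar>t\<bar>)" if "\<bar>t\<bar> \<le> T" for k t
      using that
    proof (induction k arbitrary: t)
      case 0
      then show ?case using C[of t "2 * L"] \<open>L > 0\<close> by simp
    next
      case (Suc k)
      show ?case
        using picard_contraction[OF _ \<open>L > 0\<close> _ D' L Suc.IH Suc.prems] \<open>C \<ge> 0\<close> Ux by simp
    qed
    define B where "B = C * exp (2 * L * T)"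
    have "B \<ge> 0" using \<open>C \<ge> 0\<close> by (simp add: B_def)
    have est': "norm (U (Suc k) t - U k t) \<le> B * (1/2) ^ k" if "\<bar>t\<bar> \<le> T" for k t
    proof -
      have "C * (1/2) ^ k * exp (2 * L * \<bar>t\<bar>) \<le> C * (1/2) ^ k * exp (2 * L * T)"
        using that \<open>C \<ge> 0\<close> \<open>L > 0\<close> by (intro mult_left_mono) auto
      then show ?thesis using est[OF that, of k] by (simp add: B_def mult_ac)
    qed
    \<comment> \<open>The right-hand side is the exact geometric sum of the bounds
      \<open>est'\<close> from \<open>k\<close> to \<open>k + m - 1\<close>, so the induction on
      \<open>m\<close> closes.\<close>
    have "norm (U (k + m) t - U k t) \<le> 2 * B * ((1/2) ^ k - (1/2) ^ (k + m))" if "\<bar>t\<bar> \<le> T" for k m t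
    proof (induction m)
      case (Suc m)
      have "norm (U (k + Suc m) t - U k t) \<le> norm (U (Suc (k + m)) t - U (k + m) t) + norm (U (k + m) t - U k t)"
        using norm_triangle_ineq[of "U (Suc (k + m)) t - U (k + m) t" "U (k + m) t - U k t"] by simp
      then show ?case using est'[OF that, of "k + m"] Suc by (simp add: algebra_simps)
    qed simp
    moreover have "2 * B * ((1/2) ^ k - (1/2) ^ (k + m)) \<le> 2 * B * (1/2) ^ k" for k m :: nat
      using \<open>B \<ge> 0\<close> by (intro mult_left_mono) auto
    ultimately show ?thesis by (intro exI[of _ "2 * B"]) (meson order_trans)
  qed
  have small: "\<exists>N. \<forall>k\<ge>N. A * (1/2) ^ k < e" if "e > 0" for A e :: real
  proof -
    have "(\<lambda>k. A * (1/2) ^ k) \<longlonglongrightarrow> A * 0" by (intro tendsto_intros LIMSEQ_power_zero) auto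
    then show ?thesis using order_tendstoD(2)[of _ 0 sequentially e] that by (auto simp: eventually_sequentially)
  qed
  have "convergent (\<lambda>k. U k t)" for t
  proof -
    obtain A where A: "\<And>k m. norm (U (k + m) t - U k t) \<le> A * (1/2) ^ k" using local[of "\<bar>t\<bar>"] by blast
    have "Cauchy (\<lambda>k. U k t)"
    proof (rule CauchyI')
      fix e :: real assume "e > 0"
      then obtain N where N: "\<And>k. k \<ge> N \<Longrightarrow> A * (1/2) ^ k < e" using small by blast
      have "norm (U m t - U n t) < e" if "m \<ge> N" "m < n" for m n
      proof -
        have "norm (U n t - U m t) < e" using A[of m "n - m"] N[OF \<open>m \<ge> N\<close>] that by simp
        then show ?thesis by (simp add: norm_minus_commute)
      qed
      then show "\<exists>M. \<forall>m\<ge>M. \<forall>n>m. dist (U m t) (U n t) < e" unfolding dist_norm by blast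
    qed
    then show ?thesis by (simp add: Cauchy_convergent_iff)
  qed
  then obtain u where u: "\<And>t. (\<lambda>k. U k t) \<longlonglongrightarrow> u t" unfolding convergent_def by metis
  have "(u has_vector_derivative f t (u t)) (at t)" for t
  proof -
    define T where "T = \<bar>t\<bar> + 1"
    define S where "S = {-T<..<T}"
    obtain A where A: "\<And>k m t. \<bar>t\<bar> \<le> T \<Longrightarrow> norm (U (k + m) t - U k t) \<le> A * (1/2) ^ k"
      using local[of T] by blast
    have uU: "norm (u s - U k s) \<le> A * (1/2) ^ k" if "\<bar>s\<bar> \<le> T" for s k
    proof (rule LIMSEQ_le_const2)
      have "(\<lambda>m. U (m + k) s) \<longlonglongrightarrow> u s" using LIMSEQ_ignore_initial_segment[OF u] .
      then show "(\<lambda>m. norm (U (m + k) s - U k s)) \<longlonglongrightarrow> norm (u s - U k s)"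
        by (intro tendsto_intros)
    qed (use A[OF that, of k] in \<open>auto simp: add.commute intro!: exI[of _ 0]\<close>)
    obtain L0 where L0: "\<And>t x y. \<bar>t\<bar> \<le> T \<Longrightarrow> norm (f t x - f t y) \<le> L0 * norm (x - y)"
      using lip[of T] by blast
    \<comment> \<open>Uniform convergence of the derivatives on \<open>S\<close>, in the operator
      form that \<open>has_derivative_sequence\<close> expects.\<close>
    have conv: "\<forall>\<^sub>F k in sequentially. \<forall>x\<in>S. \<forall>h. norm (h *\<^sub>R f x (U k x) - h *\<^sub>R f x (u x)) \<le> e * norm h"
      if "e > 0" for e
    proof -
      obtain N where N: "\<And>k. k \<ge> N \<Longrightarrow> \<bar>L0\<bar> * A * (1/2) ^ k < e" using small[OF \<open>e > 0\<close>] by blast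
      have "norm (h *\<^sub>R f x (U k x) - h *\<^sub>R f x (u x)) \<le> e * norm h" if "k \<ge> N" "x \<in> S" for k x h
      proof -
        have x: "\<bar>x\<bar> \<le> T" using \<open>x \<in> S\<close> by (auto simp: S_def)
        have "norm (f x (U k x) - f x (u x)) \<le> L0 * norm (U k x - u x)" by (rule L0[OF x])
        also have "\<dots> \<le> \<bar>L0\<bar> * norm (u x - U k x)" 
          by (subst norm_minus_commute) (intro mult_right_mono, auto)
        also have "\<dots> \<le> \<bar>L0\<bar> * (A * (1/2) ^ k)" by (intro mult_left_mono uU x) auto
        also have "\<dots> \<le> e" using N[OF \<open>k \<ge> N\<close>] by (simp add: mult.assoc)
        finally have "norm h * norm (f x (U k x) - f x (u x)) \<le> norm h * e"
          by (rule mult_left_mono) auto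
        then show ?thesis by (simp add: scaleR_diff_right[symmetric] mult.commute)
      qed
      then show ?thesis by (auto simp: eventually_sequentially)
    qed
    \<comment> \<open>The sequence is shifted by one because the derivative of
      \<open>U (Suc k)\<close> is given by \<open>U k\<close>.\<close>
    have "\<exists>g. \<forall>x\<in>S. (\<lambda>k. U (Suc k) x) \<longlonglongrightarrow> g x \<and> (g has_derivative (\<lambda>h. h *\<^sub>R f x (u x))) (at x within S)"
    proof (rule has_derivative_sequence[where f' = "\<lambda>k x h. h *\<^sub>R f x (U k x)" and ?x0.0 = 0])
      show "convex S" by (simp add: S_def)
      have "T > 0" by (simp add: T_def add_nonneg_pos)
      then show "0 \<in> S" by (simp add: S_def)
      show "(U (Suc k) has_derivative (\<lambda>h. h *\<^sub>R f x (U k x))) (at x within S)" for k x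
        using U'[of k x] unfolding has_vector_derivative_def by (rule has_derivative_at_withinI)
      show "(\<lambda>k. U (Suc k) 0) \<longlonglongrightarrow> x0" by (simp add: Ux)
    qed (rule conv)
    then obtain g where g: "\<And>x. x \<in> S \<Longrightarrow> (\<lambda>k. U (Suc k) x) \<longlonglongrightarrow> g x"
      "\<And>x. x \<in> S \<Longrightarrow> (g has_derivative (\<lambda>h. h *\<^sub>R f x (u x))) (at x within S)" by blast
    have gu: "g x = u x" if "x \<in> S" for x
      using LIMSEQ_unique[OF g(1)[OF that] LIMSEQ_Suc[OF u]] .
    have "open S" by (simp add: S_def)
    have "t \<in> S" unfolding S_def T_def by (auto simp: abs_real_def)
    have "(g has_vector_derivative f t (u t)) (at t)"
      using g(2)[OF \<open>t \<in> S\<close>]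
      unfolding has_vector_derivative_def at_within_open[OF \<open>t \<in> S\<close> \<open>open S\<close>] .
    then show ?thesis
      by (rule has_vector_derivative_transform_within_open[OF _ \<open>open S\<close> \<open>t \<in> S\<close>]) (rule gu)
  qed
  moreover have "u 0 = x0" using LIMSEQ_unique[OF u[of 0]] by (simp add: Ux)
  ultimately show ?thesis by (intro that)
qed

section \<open>Calculus of bounded Lipschitz functions\<close>

text \<open>The bound \<open>B\<close> is included so that the class is closed under products; the
  clamped right-hand side is assembled from such factors.\<close>

definition lipschitz_bounded :: "real \<Rightarrow> (real \<Rightarrow> 'a::real_normed_vector \<Rightarrow> real) \<Rightarrow> bool" where
  "lipschitz_bounded T g \<longleftrightarrow> (\<exists>B L. \<forall>t x y. \<bar>t\<bar> \<le> T \<longrightarrow>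
     \<bar>g t x\<bar> \<le> B \<and> \<bar>g t x - g t y\<bar> \<le> L * norm (x - y))"

lemma lipschitz_bounded_const: "lipschitz_bounded T (\<lambda>t x. k)"
  unfolding lipschitz_bounded_def by (intro exI[of _ "\<bar>k\<bar>"] exI[of _ 0]) simp

lemma lipschitz_bounded_diff:
  assumes "lipschitz_bounded T g" "lipschitz_bounded T h"
  shows "lipschitz_bounded T (\<lambda>t x. g t x - h t x)"
proof -
  obtain A K B L where g: "\<And>t x y. \<bar>t\<bar> \<le> T \<Longrightarrow> \<bar>g t x\<bar> \<le> A \<and> \<bar>g t x - g t y\<bar> \<le> K * norm (x - y)"
    and h: "\<And>t x y. \<bar>t\<bar> \<le> T \<Longrightarrow> \<bar>h t x\<bar> \<le> B \<and> \<bar>h t x - h t y\<bar> \<le> L * norm (x - y)"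
    using assms unfolding lipschitz_bounded_def by metis
  have "\<bar>g t x - h t x\<bar> \<le> A + B" "\<bar>(g t x - h t x) - (g t y - h t y)\<bar> \<le> (K + L) * norm (x - y)"
    if "\<bar>t\<bar> \<le> T" for t x y
    using g[OF that, of x y] h[OF that, of x y] unfolding distrib_right by linarith+
  then show ?thesis unfolding lipschitz_bounded_def by blast
qed

lemma lipschitz_bounded_mult:
  assumes "lipschitz_bounded T g" "lipschitz_bounded T h"
  shows "lipschitz_bounded T (\<lambda>t x. g t x * h t x)"
proof -
  obtain A K B L where g: "\<And>t x y. \<bar>t\<bar> \<le> T \<Longrightarrow> \<bar>g t x\<bar> \<le> A \<and> \<bar>g t x - g t y\<bar> \<le> K * norm (x - y)"
    and h: "\<And>t x y. \<bar>t\<bar> \<le> T \<Longrightarrow> \<bar>h t x\<bar> \<le> B \<and> \<bar>h t x - h t y\<bar> \<le> L * norm (x - y)"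
    using assms unfolding lipschitz_bounded_def by metis
  have "\<bar>g t x * h t x\<bar> \<le> A * B"
    "\<bar>g t x * h t x - g t y * h t y\<bar> \<le> (A * L + B * K) * norm (x - y)"
    if "\<bar>t\<bar> \<le> T" for t x y
  proof -
    note g = g[OF that, of x y] and h = h[OF that, of x y] h[OF that, of y x]
    then have "A \<ge> 0" "B \<ge> 0" by linarith+
    show "\<bar>g t x * h t x\<bar> \<le> A * B"
      unfolding abs_mult using g h \<open>A \<ge> 0\<close> by (intro mult_mono) auto
    have "g t x * h t x - g t y * h t y = g t x * (h t x - h t y) + h t y * (g t x - g t y)"
      by (simp add: algebra_simps)
    then have "\<bar>g t x * h t x - g t y * h t y\<bar> \<le> \<bar>g t x\<bar> * \<bar>h t x - h t y\<bar> + \<bar>h t y\<bar> * \<bar>g t x - g t y\<bar>"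
      by (metis abs_mult abs_triangle_ineq)
    also have "\<dots> \<le> A * (L * norm (x - y)) + B * (K * norm (x - y))"
      using g h \<open>A \<ge> 0\<close> \<open>B \<ge> 0\<close> by (intro add_mono mult_mono) auto
    finally show "\<bar>g t x * h t x - g t y * h t y\<bar> \<le> (A * L + B * K) * norm (x - y)"
      by (simp add: algebra_simps)
  qed
  then show ?thesis unfolding lipschitz_bounded_def by blast
qed

text \<open>On \<open>[m, \<infinity>)\<close> the reciprocal is bounded by \<open>1 / m\<close> and
  has Lipschitz constant \<open>1 / m\<^sup>2\<close>. The inner \<open>g\<close> may be unbounded,
  as \<open>r\<close> and \<open>r - y * p\<close> are.\<close>

lemma lipschitz_bounded_inverse_max:
  assumes "m > 0" and "\<And>t x y. \<bar>t\<bar> \<le> T \<Longrightarrow> \<bar>g t x - g t y\<bar> \<le> L * norm (x - y)"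
  shows "lipschitz_bounded T (\<lambda>t x. 1 / max (g t x) m)"
proof -
  have "\<bar>1 / max (g t x) m\<bar> \<le> 1 / m" for t x
    using \<open>m > 0\<close> by (simp add: divide_simps) 
  moreover have "\<bar>1 / max (g t x) m - 1 / max (g t y) m\<bar> \<le> L / m\<^sup>2 * norm (x - y)"
    if "\<bar>t\<bar> \<le> T" for t x y
  proof -
    let ?a = "max (g t x) m" and ?b = "max (g t y) m"
    have "\<bar>1 / ?a - 1 / ?b\<bar> = \<bar>?b - ?a\<bar> / (?a * ?b)"
    proof -
      have pos: "?a > 0" "?b > 0" using \<open>m > 0\<close> by auto
      then have "1 / ?a - 1 / ?b = (?b - ?a) / (?a * ?b)" by (simp add: field_simps)
      moreover have "\<bar>?a * ?b\<bar> = ?a * ?b" using mult_pos_pos[OF pos] by linarith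
      ultimately show ?thesis by (simp only: abs_divide)
    qed
    also have "\<dots> \<le> \<bar>g t x - g t y\<bar> / (m * m)"
      using \<open>m > 0\<close> by (intro frac_le mult_mono) auto
    also have "\<dots> \<le> L * norm (x - y) / (m * m)"
      using assms(2)[OF that] by (intro divide_right_mono) auto
    finally show ?thesis by (simp add: power2_eq_square)
  qed
  ultimately show ?thesis unfolding lipschitz_bounded_def by blast
qed

subsection \<open>The invariant region\<close>

locale imcf_parameters =
  fixes c lam \<mu> :: real
  assumes c_pos: "c > 0" and lam_pos: "lam > 0" and c_lam: "c * lam > 1" and mu_pos: "\<mu> > 0"
begin

text \<open>The equation solved for the second derivative, with \<open>p\<close> standing for
  \<open>r'\<close>.\<close>

definition rhs :: "real \<Rightarrow> real \<Rightarrow> real \<Rightarrow> real" where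
  "rhs y r p = (1 + p\<^sup>2) * (c / r - (1 + p\<^sup>2) / (lam * (r - y * p)))"

text \<open>Chosen so that \<open>c * lam * W0 = \<mu>\<close>: at \<open>w = W0\<close> the sign
  factor of \<open>rhs\<close> is \<open>\<mu> - (1 + p\<^sup>2) * r\<close>, negative once
  \<open>r > \<mu>\<close>.\<close>

definition W0 :: real where "W0 = \<mu> / (c * lam)"

text \<open>The condition \<open>0 \<le> p\<close> of the invariant set is left out, which keeps the region symmetric under
  \<open>(y, p) \<mapsto> (- y, - p)\<close>.\<close>

definition region :: "real \<Rightarrow> real \<Rightarrow> real \<Rightarrow> bool" where
  "region y r p \<longleftrightarrow> \<mu> \<le> r \<and> 1 + p\<^sup>2 \<le> c * lam \<and> W0 \<le> r - y * p"

lemma W0_pos: "W0 > 0"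
  using c_lam mu_pos by (simp add: W0_def)

lemma W0_less_mu: "W0 < \<mu>"
  using c_lam mu_pos by (simp add: W0_def divide_simps)

lemma region_reflect: "region (- y) r (- p) = region y r p"
  by (simp add: region_def)

text \<open>Over the common denominator \<open>lam * r * (r - y * p)\<close>, positive in the
  region, the bracket in \<open>rhs\<close> leaves a polynomial that alone decides the sign.\<close>

lemma rhs_factor:
  assumes "region y r p"
  obtains k where "k > 0" and "rhs y r p = k * (c * lam * (r - y * p) - (1 + p\<^sup>2) * r)"
proof
  have pos: "r > 0" "r - y * p > 0"
    using assms mu_pos W0_pos by (auto simp: region_def)
  let ?w = "r - y * p" and ?s = "1 + p\<^sup>2"
  have "?s > 0" by (simp add: add_pos_nonneg)
  then show "?s / (lam * r * ?w) > 0"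
    using pos lam_pos by simp
  show "rhs y r p = ?s / (lam * r * ?w) * (c * lam * ?w - ?s * r)"
    using pos lam_pos unfolding rhs_def by (simp add: field_simps)
qed

text \<open>First-exit argument for the invariant set. The equation is assumed only inside the
  region, so the lemma applies to the original and to the clamped equation alike.\<close>

lemma trapped:
  assumes r': "\<And>y. (r has_real_derivative p y) (at y)"
    and p': "\<And>y. (p has_real_derivative q y) (at y)"
    and init: "r 0 = \<mu>" "p 0 = 0"
    and ode: "\<And>y. y \<ge> 0 \<Longrightarrow> region y (r y) (p y) \<Longrightarrow> q y = rhs y (r y) (p y)"
    and "y \<ge> 0"
  shows "region y (r y) (p y) \<and> 0 \<le> p y"
proof (rule ccontr)
  define R where "R y \<longleftrightarrow> region y (r y) (p y) \<and> 0 \<le> p y" for y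
  define w where "w y = r y - y * p y" for y
  have w': "(w has_real_derivative - (y * q y)) (at y)" for y
    unfolding w_def by (auto intro!: derivative_eq_intros r' p')
  have contr: "isCont r y" and contp: "isCont p y" and contw: "isCont w y" for y
    using DERIV_isCont r' p' w' by blast+
  have contq: "((\<lambda>x. 1 + (p x)\<^sup>2) \<longlongrightarrow> 1 + (p y)\<^sup>2) (nhds y)" for y
    using contp[of y] unfolding isCont_def tendsto_at_iff_tendsto_nhds by (intro tendsto_intros)
  have R0: "R 0"
    using init c_lam W0_less_mu by (simp add: R_def region_def)
  have sign: "\<exists>k>0. q y = k * (c * lam * w y - (1 + (p y)\<^sup>2) * r y)" if "y \<ge> 0" "R y" for y
  proof -
    have reg: "region y (r y) (p y)" using that by (simp add: R_def)
    show ?thesis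
      unfolding ode[OF that(1) reg] w_def by (rule rhs_factor[OF reg]) blast
  qed
  \<comment> \<open>Equality at \<open>y\<close> would, by the sign of a derivative there, force a
    violation just to the left of \<open>y\<close>. The order matters: \<open>p y > 0\<close> gives
    \<open>r y > \<mu>\<close>, and these two settle the remaining inequalities.\<close>
  have strict: "0 < p y \<and> \<mu> < r y \<and> 1 + (p y)\<^sup>2 < c * lam \<and> W0 < w y"
    if "y > 0" and below: "\<And>x. 0 \<le> x \<Longrightarrow> x \<le> y \<Longrightarrow> R x" for y
  proof -
    have le: "\<mu> \<le> r x" "0 \<le> p x" "1 + (p x)\<^sup>2 \<le> c * lam" "W0 \<le> w x" if "0 \<le> x" "x \<le> y" for x
      using below[OF that] by (auto simp: R_def region_def w_def)
    obtain k where k: "k > 0" "q y = k * (c * lam * w y - (1 + (p y)\<^sup>2) * r y)"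
      using sign[of y] below[of y] less_imp_le[OF \<open>y > 0\<close>] by blast
    \<comment> \<open>Turns a property valid just to the left of \<open>y\<close> into a point of
      \<open>[0, y]\<close>; the step \<open>min y (d / 2)\<close> is below \<open>d\<close> and
      does not pass \<open>0\<close>.\<close>
    have near: "\<exists>x. 0 \<le> x \<and> x \<le> y \<and> P x" if left: "\<exists>d>0. \<forall>h>0. h < d \<longrightarrow> P (y - h)" for P
    proof -
      obtain d where "d > 0" and d: "\<And>h. h > 0 \<Longrightarrow> h < d \<Longrightarrow> P (y - h)" using left by blast
      have "P (y - min y (d / 2))" using \<open>d > 0\<close> \<open>y > 0\<close> by (intro d) auto
      then show ?thesis using \<open>d > 0\<close> \<open>y > 0\<close> by (intro exI[of _ "y - min y (d / 2)"]) auto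
    qed
    have "p y \<noteq> 0"
    proof
      assume "p y = 0"
      then have "c * lam * w y - (1 + (p y)\<^sup>2) * r y = (c * lam - 1) * r y"
        by (simp add: w_def algebra_simps)
      moreover have "\<dots> > 0" using c_lam le(1)[of y] mu_pos \<open>y > 0\<close> by simp
      ultimately have "q y > 0" using k by simp
      from near[OF DERIV_pos_inc_left[OF p' this]] show False
        using le(2) \<open>p y = 0\<close> by force
    qed
    then have p: "p y > 0" using le(2)[of y] \<open>y > 0\<close> by simp
    have "r y \<noteq> \<mu>"
      using near[OF DERIV_pos_inc_left[OF r' p]] le(1) by force
    then have r: "r y > \<mu>" using le(1)[of y] \<open>y > 0\<close> by simp
    have "1 + (p y)\<^sup>2 \<noteq> c * lam"
    proof
      assume eq: "1 + (p y)\<^sup>2 = c * lam"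
      have "c * lam * w y - (1 + (p y)\<^sup>2) * r y = - (c * lam * y * p y)"
        unfolding eq by (simp add: w_def algebra_simps)
      moreover have "\<dots> < 0" using c_lam \<open>y > 0\<close> p by simp
      ultimately have "q y < 0" using k by (simp add: mult_less_0_iff)
      from near[OF DERIV_neg_dec_left[OF p' this]] obtain x where x: "0 \<le> x" "x \<le> y" "p y < p x"
        by blast
      then have "(p y)\<^sup>2 < (p x)\<^sup>2" using p by (intro power_strict_mono) auto
      then show False using le(3)[OF x(1,2)] eq by simp
    qed
    moreover have "w y \<noteq> W0"
    proof
      assume eq: "w y = W0"
      have "c * lam * w y - (1 + (p y)\<^sup>2) * r y = (\<mu> - r y) - (p y)\<^sup>2 * r y"
        unfolding eq W0_def using c_pos lam_pos by (simp add: algebra_simps)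
      moreover have "\<dots> < 0"
        using r mu_pos by (smt (verit) mult_nonneg_nonneg zero_le_power2)
      ultimately have "q y < 0" using k by (simp add: mult_less_0_iff)
      then have "- (y * q y) > 0" using \<open>y > 0\<close> by (simp add: mult_less_0_iff)
      from near[OF DERIV_pos_inc_left[OF w' this]] show False using le(4) eq by force
    qed
    ultimately show ?thesis using p r le[of y] \<open>y > 0\<close> by force
  qed
  \<comment> \<open>For \<open>y > 0\<close> strictness and continuity suffice. At
    \<open>y = 0\<close> both \<open>p\<close> and \<open>r\<close> lie on the boundary: there
    \<open>q 0 > 0\<close> makes \<open>p\<close> positive to the right, and then \<open>r\<close>
    increases.\<close>
  have extend: "\<exists>e>0. \<forall>x. y \<le> x \<and> x < y + e \<longrightarrow> R x"
    if "y \<ge> 0" and below: "\<And>x. 0 \<le> x \<Longrightarrow> x \<le> y \<Longrightarrow> R x" for y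
  proof (cases "y = 0")
    case False
    note st = strict[OF _ below]
    have "\<forall>\<^sub>F x in nhds y. 0 < p x \<and> \<mu> < r x \<and> 1 + (p x)\<^sup>2 < c * lam \<and> W0 < w x"
      using st False \<open>y \<ge> 0\<close> contr[of y] contp[of y] contw[of y] contq[of y]
      unfolding isCont_def tendsto_at_iff_tendsto_nhds
      by (intro eventually_conj) (auto intro: order_tendstoD)
    then have "\<forall>\<^sub>F x in nhds y. R x"
      by eventually_elim (auto simp: R_def region_def w_def)
    then show ?thesis
      unfolding eventually_nhds_metric by (force simp: dist_real_def)
  next
    case True
    obtain k where k: "k > 0" "q 0 = k * (c * lam * w 0 - (1 + (p 0)\<^sup>2) * r 0)"
      using sign[of 0] R0 by auto
    have "c * lam * w 0 - (1 + (p 0)\<^sup>2) * r 0 = (c * lam - 1) * \<mu>"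
      by (simp add: w_def init algebra_simps)
    then have "q 0 > 0" using k c_lam mu_pos by simp
    from DERIV_pos_inc_right[OF p' this] obtain d where "d > 0"
      and d: "\<And>h. 0 < h \<Longrightarrow> h < d \<Longrightarrow> 0 < p h" by (auto simp: init)
    have "\<forall>\<^sub>F x in nhds 0. 1 + (p x)\<^sup>2 < c * lam \<and> W0 < w x"
      using contq[of 0] contw[of 0] c_lam W0_less_mu
      unfolding isCont_def tendsto_at_iff_tendsto_nhds
      by (intro eventually_conj) (auto elim!: order_tendstoD simp: init w_def[of 0])
    then obtain e where "e > 0" and e: "\<And>x. \<bar>x\<bar> < e \<Longrightarrow> 1 + (p x)\<^sup>2 < c * lam \<and> W0 < w x"
      unfolding eventually_nhds_metric by (auto simp: dist_real_def)
    have "R x" if "0 \<le> x" "x < min d e" for x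
    proof (cases "x = 0")
      case False
      have "r 0 \<le> r x"
      proof (rule DERIV_nonneg_imp_nondecreasing[OF \<open>0 \<le> x\<close>])
        show "\<exists>y. (r has_real_derivative y) (at z) \<and> 0 \<le> y" if "0 \<le> z" "z \<le> x" for z
          using r' d[of z] init that \<open>x < min d e\<close> by (cases "z = 0") (auto intro!: exI[of _ "p z"])
      qed
      then show ?thesis
        using False that e[of x] d[of x] init by (auto simp: R_def region_def w_def)
    qed (use R0 in simp)
    then show ?thesis
      using True \<open>d > 0\<close> \<open>e > 0\<close> by (intro exI[of _ "min d e"]) auto
  qed
  assume "\<not> (region y (r y) (p y) \<and> 0 \<le> p y)"
  then have "\<not> R y" by (simp add: R_def)
  \<comment> \<open>At the infimum \<open>m\<close> of the bad points \<open>R\<close> still holds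
    by closedness, so \<open>extend\<close> pushes all bad points beyond \<open>m\<close>, a
    contradiction.\<close>
  define Bad where "Bad = {x. 0 \<le> x \<and> \<not> R x}"
  define m where "m = Inf Bad"
  have Bad: "Bad \<noteq> {}" "bdd_below Bad"
    using \<open>\<not> R y\<close> \<open>y \<ge> 0\<close> by (auto simp: Bad_def bdd_below_def)
  have m0: "m \<ge> 0" unfolding m_def using Bad by (intro cInf_greatest) (auto simp: Bad_def)
  have Rlt: "R x" if "0 \<le> x" "x < m" for x
    using cInf_lower[OF _ Bad(2), of x] that by (force simp: m_def Bad_def)
  have "closed {x. R x}"
    unfolding R_def region_def
    by (intro closed_Collect_conj closed_Collect_le continuous_intros
        continuous_at_imp_continuous_on ballI contr contp)
  have "R m"
  proof (cases "m = 0")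
    case False
    have "closure {0..<m} \<subseteq> {x. R x}"
      using Rlt \<open>closed {x. R x}\<close> by (intro closure_minimal) auto
    then show ?thesis using m0 False by auto
  qed (use R0 in simp)
  then have "R x" if "0 \<le> x" "x \<le> m" for x
    using Rlt[of x] that by (cases "x = m") auto
  from extend[OF m0 this] obtain e where "e > 0" and e: "\<And>x. m \<le> x \<Longrightarrow> x < m + e \<Longrightarrow> R x"
    by blast
  have "m + e \<le> x" if "x \<in> Bad" for x
    using that Rlt[of x] e[of x] by (force simp: Bad_def)
  then have "m + e \<le> m" unfolding m_def using Bad by (intro cInf_greatest) auto
  then show False using \<open>e > 0\<close> by simp
qed

text \<open>Negative \<open>y\<close> are reduced to positive ones by the reflection symmetry of the
  region.\<close>

lemma trapped_even:
  assumes r': "\<And>y. (r has_real_derivative p y) (at y)"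
    and p': "\<And>y. (p has_real_derivative q y) (at y)"
    and init: "r 0 = \<mu>" "p 0 = 0"
    and ode: "\<And>y. y \<ge> 0 \<Longrightarrow> region y (r y) (p y) \<Longrightarrow> q y = rhs y (r y) (p y)"
    and even: "\<And>y. r (- y) = r y" "\<And>y. p (- y) = - p y"
  shows "region y (r y) (p y)"
proof (cases "y \<ge> 0")
  case True
  then show ?thesis using trapped[of r p q y] r' p' init ode by blast
next
  case False
  then have "region (- y) (r (- y)) (p (- y))" using trapped[of r p q "- y"] r' p' init ode by force
  then show ?thesis by (simp only: even region_reflect)
qed

subsection \<open>The clamped equation\<close>

text \<open>\<open>\<bar>p\<bar>\<close> is cut off where \<open>1 + p\<^sup>2\<close> reaches
  \<open>c * lam\<close>. Cutting \<open>\<bar>p\<bar>\<close> rather than \<open>p\<close> keeps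
  the function even.\<close>

definition clamped_slope :: "real \<Rightarrow> real" where
  "clamped_slope p = 1 + (min \<bar>p\<bar> (sqrt (c * lam - 1)))\<^sup>2"

text \<open>Written with factors \<open>1 / max\<close> so that the closure rules for
  \<open>lipschitz_bounded\<close> apply syntactically.\<close>

definition clamped_rhs :: "real \<Rightarrow> real \<Rightarrow> real \<Rightarrow> real" where
  "clamped_rhs y r p = clamped_slope p * (c * (1 / max r \<mu>) - clamped_slope p * (1 / lam) * (1 / max (r - y * p) W0))"

lemma clamped_rhs_eq:
  assumes "region y r p"
  shows "clamped_rhs y r p = rhs y r p"
proof -
  have "p\<^sup>2 \<le> c * lam - 1" using assms by (simp add: region_def)
  then have "\<bar>p\<bar> \<le> sqrt (c * lam - 1)" by (simp add: real_le_rsqrt)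
  then have "clamped_slope p = 1 + p\<^sup>2" by (simp add: clamped_slope_def min_def)
  moreover have "max r \<mu> = r" "max (r - y * p) W0 = r - y * p"
    using assms by (auto simp: region_def)
  ultimately show ?thesis by (simp add: clamped_rhs_def rhs_def)
qed

lemma clamped_rhs_reflect: "clamped_rhs (- y) r (- p) = clamped_rhs y r p"
  by (simp add: clamped_rhs_def clamped_slope_def)

lemma lipschitz_bounded_clamped_slope: "lipschitz_bounded T (\<lambda>t x. clamped_slope (snd x))"
proof -
  define P where "P = sqrt (c * lam - 1)"
  have "P > 0" using c_lam by (simp add: P_def)
  have bdd: "\<bar>clamped_slope p\<bar> \<le> 1 + P\<^sup>2" for p
  proof -
    have "(min \<bar>p\<bar> P)\<^sup>2 \<le> P\<^sup>2" using \<open>P > 0\<close> by (intro power_mono) auto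
    then show ?thesis by (simp add: clamped_slope_def P_def[symmetric])
  qed
  have lip: "\<bar>clamped_slope p - clamped_slope p'\<bar> \<le> 2 * P * \<bar>p - p'\<bar>" for p p'
  proof -
    let ?a = "min \<bar>p\<bar> P" and ?b = "min \<bar>p'\<bar> P"
    \<comment> \<open>Difference of squares: the sum of the cut-off values is at most
      \<open>2 * P\<close>, and cutting off does not increase distances.\<close>
    have "clamped_slope p - clamped_slope p' = (?a + ?b) * (?a - ?b)"
      by (simp add: clamped_slope_def P_def[symmetric] power2_eq_square algebra_simps)
    then have "\<bar>clamped_slope p - clamped_slope p'\<bar> = \<bar>?a + ?b\<bar> * \<bar>?a - ?b\<bar>"
      by (simp add: abs_mult)
    also have "\<dots> \<le> (2 * P) * \<bar>p - p'\<bar>"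
      using \<open>P > 0\<close> by (intro mult_mono) (auto simp: abs_real_def min_def)
    finally show ?thesis .
  qed
  have "\<bar>clamped_slope (snd x) - clamped_slope (snd y)\<bar> \<le> 2 * P * norm (x - y)"
    for x y :: "'a::real_normed_vector \<times> real"
  proof -
    have "\<bar>snd x - snd y\<bar> \<le> norm (x - y)" using dist_snd_le[of x y] by (simp add: dist_norm)
    then show ?thesis
      using lip[of "snd x" "snd y"] \<open>P > 0\<close> by (smt (verit) mult_left_mono)
  qed
  then show ?thesis using bdd unfolding lipschitz_bounded_def by blast
qed

lemma lipschitz_bounded_clamped_rhs: "lipschitz_bounded T (\<lambda>t x. clamped_rhs t (fst x) (snd x))"
  unfolding clamped_rhs_def
proof (intro lipschitz_bounded_mult lipschitz_bounded_diff lipschitz_bounded_const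
    lipschitz_bounded_clamped_slope lipschitz_bounded_inverse_max)
  show "\<bar>fst x - fst y\<bar> \<le> 1 * norm (x - y)" for x y :: "real \<times> real"
    using dist_fst_le[of x y] by (simp add: dist_norm)
  \<comment> \<open>The factor \<open>t\<close> makes this constant grow with \<open>T\<close>,
    which is why Lipschitz bounds are uniform only on bounded time intervals.\<close>
  show "\<bar>(fst x - t * snd x) - (fst y - t * snd y)\<bar> \<le> (1 + \<bar>T\<bar>) * norm (x - y)"
    if "\<bar>t\<bar> \<le> T" for t and x y :: "real \<times> real"
  proof -
    have "(fst x - t * snd x) - (fst y - t * snd y) = fst (x - y) - t * snd (x - y)"
      by (simp add: algebra_simps)
    also have "\<bar>\<dots>\<bar> \<le> \<bar>fst (x - y)\<bar> + \<bar>t\<bar> * \<bar>snd (x - y)\<bar>"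
      by (metis abs_mult abs_triangle_ineq4)
    also have "\<dots> \<le> norm (x - y) + \<bar>T\<bar> * norm (x - y)"
      using that dist_fst_le[of x y] dist_snd_le[of x y]
      by (intro add_mono mult_mono) (auto simp: dist_norm)
    finally show ?thesis by (simp add: algebra_simps)
  qed
qed (simp_all add: mu_pos W0_pos)

definition clamped_field :: "real \<Rightarrow> real \<times> real \<Rightarrow> real \<times> real" where
  "clamped_field t x = (snd x, clamped_rhs t (fst x) (snd x))"

lemma clamped_field_lipschitz: "\<exists>L. \<forall>t x y. \<bar>t\<bar> \<le> T \<longrightarrow> norm (clamped_field t x - clamped_field t y) \<le> L * norm (x - y)"
proof -
  obtain L where L: "\<And>t x y. \<bar>t\<bar> \<le> T \<Longrightarrow>
      \<bar>clamped_rhs t (fst x) (snd x) - clamped_rhs t (fst y) (snd y)\<bar> \<le> L * norm (x - y)"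
    using lipschitz_bounded_clamped_rhs[of T] unfolding lipschitz_bounded_def by metis
  have "norm (clamped_field t x - clamped_field t y) \<le> (1 + L) * norm (x - y)" if "\<bar>t\<bar> \<le> T" for t x y
  proof -
    have "norm (clamped_field t x - clamped_field t y) \<le>
        \<bar>snd x - snd y\<bar> + \<bar>clamped_rhs t (fst x) (snd x) - clamped_rhs t (fst y) (snd y)\<bar>"
      using norm_Pair_le[of "snd x - snd y" "clamped_rhs t (fst x) (snd x) - clamped_rhs t (fst y) (snd y)"]
      by (simp add: clamped_field_def)
    then show ?thesis
      using L[OF that, of x y] dist_snd_le[of x y] by (simp add: dist_norm distrib_right)
  qed
  then show ?thesis by blast
qed

lemma clamped_rhs_continuous:
  assumes "continuous_on UNIV r" "continuous_on UNIV p"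
  shows "continuous_on UNIV (\<lambda>t. clamped_rhs t (r t) (p t))"
  unfolding clamped_rhs_def clamped_slope_def using mu_pos W0_pos
  by (intro continuous_intros assms) (auto simp: max_def)

lemma clamped_field_continuous:
  assumes "continuous_on UNIV u"
  shows "continuous_on UNIV (\<lambda>t. clamped_field t (u t))"
  unfolding clamped_field_def
  by (intro continuous_on_Pair clamped_rhs_continuous continuous_on_fst continuous_on_snd assms)

lemma clamped_field_solution_unique:
  assumes "\<And>t. (u has_vector_derivative clamped_field t (u t)) (at t)"
    and "\<And>t. (v has_vector_derivative clamped_field t (v t)) (at t)"
    and "u 0 = v 0"
  shows "u = v"
  using clamped_field_lipschitz assms by (rule ode_unique)

section \<open>Existence and uniqueness of the even solution\<close>

text \<open>The clamped equation has a global solution, even by uniqueness; being even, it stays in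
  the region, where clamping changes nothing.\<close>

lemma global_even_solution:
  obtains r p where
    "\<And>y. (r has_real_derivative p y) (at y)"
    "\<And>y. (p has_real_derivative rhs y (r y) (p y)) (at y)"
    "continuous_on UNIV (\<lambda>y. rhs y (r y) (p y))"
    "r 0 = \<mu>" "p 0 = 0" "\<And>y. r (- y) = r y" "\<And>y. region y (r y) (p y)"
proof -
  obtain u where u0: "u 0 = (\<mu>, 0)" and u': "\<And>t. (u has_vector_derivative clamped_field t (u t)) (at t)"
    using ode_exists[of clamped_field "(\<mu>, 0)"] clamped_field_lipschitz clamped_field_continuous by metis
  define r p where "r t = fst (u t)" and "p t = snd (u t)" for t
  have r': "(r has_real_derivative p y) (at y)" for y
    using bounded_linear.has_vector_derivative[OF bounded_linear_fst u', of y]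
    by (simp add: has_real_derivative_iff_has_vector_derivative clamped_field_def r_def[abs_def] p_def)
  have p': "(p has_real_derivative clamped_rhs y (r y) (p y)) (at y)" for y
    using bounded_linear.has_vector_derivative[OF bounded_linear_snd u', of y]
    by (simp add: has_real_derivative_iff_has_vector_derivative clamped_field_def r_def p_def[abs_def])
  have init: "r 0 = \<mu>" "p 0 = 0" by (simp_all add: r_def p_def u0)
  \<comment> \<open>The reflected curve solves the same clamped initial value problem.\<close>
  have "(\<lambda>t. (r (- t), - p (- t))) = u"
  proof (rule clamped_field_solution_unique[OF _ u'])
    fix t
    have "((\<lambda>t. r (- t)) has_real_derivative - p (- t)) (at t)"
      "((\<lambda>t. - p (- t)) has_real_derivative clamped_rhs t (r (- t)) (- p (- t))) (at t)"
      using r'[of "- t"] DERIV_minus[OF iffD1[OF DERIV_mirror p'[of "- t"]]]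
        clamped_rhs_reflect[of t "r (- t)" "- p (- t)"]
      by (simp_all add: DERIV_mirror)
    then show "((\<lambda>t. (r (- t), - p (- t))) has_vector_derivative clamped_field t (r (- t), - p (- t))) (at t)"
      unfolding has_real_derivative_iff_has_vector_derivative clamped_field_def
      by (auto intro: has_vector_derivative_Pair)
  qed (simp add: init u0)
  then have even: "r (- y) = r y" "p (- y) = - p y" for y
    by (metis fst_conv r_def, metis snd_conv p_def minus_minus)
  have reg: "region y (r y) (p y)" for y
    using r' p' init clamped_rhs_eq even by (rule trapped_even)
  have "continuous_on UNIV r" "continuous_on UNIV p"
    using r' p' by (auto intro!: continuous_at_imp_continuous_on DERIV_isCont)
  then have "continuous_on UNIV (\<lambda>y. clamped_rhs y (r y) (p y))" by (rule clamped_rhs_continuous)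
  then show ?thesis
    using that[of r p] r' p' init even reg by (simp add: clamped_rhs_eq)
qed

text \<open>Both solutions are trapped in the region, hence solve the clamped equation, whose
  initial value problem has only one solution.\<close>

lemma even_solution_unique:
  assumes r': "\<And>y. (r has_real_derivative p y) (at y)"
    and p': "\<And>y. (p has_real_derivative rhs y (r y) (p y)) (at y)"
    and r: "r 0 = \<mu>" "p 0 = 0" "\<And>y. r (- y) = r y"
    and s': "\<And>y. (s has_real_derivative q y) (at y)"
    and q': "\<And>y. (q has_real_derivative rhs y (s y) (q y)) (at y)"
    and s: "s 0 = \<mu>" "q 0 = 0" "\<And>y. s (- y) = s y"
  shows "s = r"
proof -
  have flow: "((\<lambda>t. (a t, b t)) has_vector_derivative clamped_field t (a t, b t)) (at t)"
    if a': "\<And>y. (a has_real_derivative b y) (at y)"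
      and b': "\<And>y. (b has_real_derivative rhs y (a y) (b y)) (at y)"
      and init: "a 0 = \<mu>" "b 0 = 0" and even: "\<And>y. a (- y) = a y" for a b t
  proof -
    \<comment> \<open>The derivative of an even function is odd.\<close>
    have odd: "b (- y) = - b y" for y
    proof -
      have "((\<lambda>y. a (- y)) has_real_derivative - b (- y)) (at y)"
        using a'[of "- y"] by (simp add: DERIV_mirror)
      then have "- b (- y) = b y" unfolding even using a' by (rule DERIV_unique)
      then show ?thesis by simp
    qed
    have "region t (a t) (b t)"
      by (rule trapped_even[OF a' b' init _ even odd]) simp
    then show ?thesis
      using a'[of t] b'[of t] unfolding has_real_derivative_iff_has_vector_derivative clamped_field_def
      by (auto intro: has_vector_derivative_Pair simp: clamped_rhs_eq)
  qed
  have "(\<lambda>t. (s t, q t)) = (\<lambda>t. (r t, p t))"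
    by (rule clamped_field_solution_unique) (use flow r' p' r s' q' s in auto)
  then show ?thesis by (metis fst_conv ext)
qed

end

section \<open>Return to the original problem\<close>

text \<open>Since \<open>1 + r'\<^sup>2\<close> never vanishes, multiplying by it solves the
  equation for \<open>r''\<close>. The parameter assumption makes the definition of
  \<open>rhs\<close> available outside its locale.\<close>

lemma is_solution_iff:
  "is_solution n lam \<mu> r \<longleftrightarrow>
    C2 r \<and> (\<forall>y. r y - y * deriv r y \<noteq> 0 \<and> r y > 0 \<and>
      deriv (deriv r) y = imcf_parameters.rhs (real n - 1) lam y (r y) (deriv r y)) \<and>
    r 0 = \<mu> \<and> deriv r 0 = 0"
  if "imcf_parameters (real n - 1) lam \<mu>"
proof -
  have "1 + (deriv r y)\<^sup>2 \<noteq> 0" for y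
    by (metis add_pos_nonneg less_irrefl zero_le_power2 zero_less_one)
  then show ?thesis
    unfolding is_solution_def imcf_parameters.rhs_def[OF that]
    by (auto simp: nonzero_divide_eq_eq mult.commute)
qed

theorem theorem1p1:
  fixes n :: nat and lam \<mu> :: real
  assumes "n \<ge> 2" and "lam > 1 / (real n - 1)" and "\<mu> > 0"
  shows "\<exists>r. (is_solution n lam \<mu> r \<and> even_fun r) \<and>
             (\<forall>s. is_solution n lam \<mu> s \<and> even_fun s \<longrightarrow> s = r) \<and>
             (\<forall>y. r y > y * deriv r y) \<and>
             deriv (deriv r) 0 = (real n - 1 - 1 / lam) * (1 / \<mu>)"
proof -
  have n1: "real n - 1 > 0" using \<open>n \<ge> 2\<close> by simp
  moreover have "lam > 0" using n1 assms(2) by (smt (verit) divide_nonneg_pos)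
  moreover have "(real n - 1) * lam > 1"
    using n1 assms(2) by (simp add: pos_divide_less_eq mult.commute)
  ultimately interpret imcf_parameters "real n - 1" lam \<mu>
    using \<open>\<mu> > 0\<close> by unfold_locales
  note sol_iff = is_solution_iff[OF imcf_parameters_axioms]
  obtain r p where r': "\<And>y. (r has_real_derivative p y) (at y)"
    and p': "\<And>y. (p has_real_derivative rhs y (r y) (p y)) (at y)"
    and cont: "continuous_on UNIV (\<lambda>y. rhs y (r y) (p y))"
    and init: "r 0 = \<mu>" "p 0 = 0" and even: "\<And>y. r (- y) = r y"
    and reg: "\<And>y. region y (r y) (p y)"
    by (rule global_even_solution) blast
  have derivs: "deriv r = p" "deriv p = (\<lambda>y. rhs y (r y) (p y))"
    using r' p' by (auto intro: DERIV_imp_deriv)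
  have pos: "r y > 0" "r y - y * p y > 0" for y
    using reg[of y] mu_pos W0_pos by (auto simp: region_def)
  have "C2 r"
    using r' p' cont unfolding C2_def derivs real_differentiable_def by blast
  then have "is_solution n lam \<mu> r \<and> even_fun r"
    unfolding sol_iff derivs even_fun_def using pos init even by (auto simp: less_imp_neq[symmetric])
  moreover have "s = r" if "is_solution n lam \<mu> s" "even_fun s" for s
  proof (rule even_solution_unique[OF r' p' init even])
    have s: "C2 s" "\<And>y. deriv (deriv s) y = rhs y (s y) (deriv s y)"
      using that(1) unfolding sol_iff by auto
    show "(s has_real_derivative deriv s y) (at y)" for y
      using s(1) by (simp add: C2_def DERIV_deriv_iff_real_differentiable)
    show "(deriv s has_real_derivative rhs y (s y) (deriv s y)) (at y)" for y
      using s(1) unfolding s(2)[symmetric] by (simp add: C2_def DERIV_deriv_iff_real_differentiable)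
  qed (use that in \<open>auto simp: is_solution_def even_fun_def\<close>)
  moreover have "y * deriv r y < r y" for y
    using pos(2)[of y] by (simp add: derivs)
  \<comment> \<open>At the origin \<open>p = 0\<close> and \<open>r - y * p = \<mu>\<close>, so
    \<open>rhs\<close> reduces to this value.\<close>
  moreover have "deriv (deriv r) 0 = (real n - 1 - 1 / lam) * (1 / \<mu>)"
    by (simp add: derivs rhs_def init diff_divide_distrib)
  ultimately show ?thesis by blast
qed

end
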